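(* Assume there are constants $K_1,K_2,K_{\partial\Omega,\Omega}$ such that for all $f\in C^1(\Omega)$ $$\mathrm{Var}_{\sigma_\beta}(f)\le K_{\partial\Omega,\Omega}\int_\Omega|\nabla f|^2\,d\lambda_\alpha,$$ $$\left(\int_\Omega f\,d\lambda_\alpha-\int_{\partial\Omega}f\,d\sigma_\beta\right)^2\le K_1\int_\Omega|\nabla f|^2\,d\lambda_\alpha+K_2\int_{\partial\Omega}|\nabla^\tau f|^2\,d\sigma_\beta .$$ Then $$C_\mu\le\max\left(C_{\lambda_\alpha}+BK_1,\; AK_2,\; \frac{\frac BA K_{\partial\Omega,\Omega}\,(C_{\sigma_\beta}+AK_2)+(C_{\lambda_\alpha}+BK_1)\,C_{\sigma_\beta}}{\frac BA K_{\partial\Omega,\Omega}+C_{\sigma_\beta}}\right).$$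
   Context: Setting and notation. $\Omega$ is a smooth compact connected Riemannian manifold of dimension $d\ge2$ with smooth connected boundary $\partial\Omega$ (the boundary is included in $\Omega$). $\lambda$ is the volume measure on $\Omega$, $\sigma$ the Hausdorff (surface) measure on $\partial\Omega$, $\nabla$ the gradient on $\Omega$, $\nabla^\tau$ the tangential gradient on $\partial\Omega$. $C^1(\Omega)$ denotes functions that are $C^1$ up to the boundary; integrals over $\partial\Omega$ of functions on $\Omega$ use their restriction (trace). $\alpha,\beta:\Omega\to\mathbb{R}$ are weights, $A:=\int_\Omega\alpha\,d\lambda$, $B:=\int_{\partial\Omega}\beta\,d\sigma$, $d\lambda_\alpha:=\frac{\alpha}{A}d\lambda$, $d\sigma_\beta:=\frac{\beta}{B}d\sigma$, $d\mu:=\alpha\,d\lambda+\beta\,d\sigma$. For a probability measure $\nu$: $\mathrm{Var}_\nu(f)=\int f^2d\nu-(\int f\,d\nu)^2$ and $\mathrm{Ent}_\nu(f^2)=\int f^2\ln(f^2)d\nu-\int f^2d\nu\,\ln\int f^2d\nu$. Standing assumptions. (1) $\mu$ is a probability measure, with $A,B\in(0,1)$, $A+B=1$. (2) $\alpha,\beta\in C(\Omega)$, $\alpha>0$ $\lambda$-a.e. on $\Omega$, $\beta>0$ $\sigma$-a.e. on $\partial\Omega$, $\sqrt\alpha\in W^{1,2}(\Omega)$, $\sqrt\beta\in W^{1,2}(\partial\Omega)$. (3) The constants $C_{\lambda_\alpha},L_{\lambda_\alpha},C_{\sigma_\beta},L_{\sigma_\beta}$ are finite, where these are the smallest constants with $\mathrm{Var}_{\lambda_\alpha}(f)\le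 C_{\lambda_\alpha}\int_\Omega|\nabla f|^2d\lambda_\alpha$ and $\mathrm{Ent}_{\lambda_\alpha}(f^2)\le L_{\lambda_\alpha}\int_\Omega|\nabla f|^2d\lambda_\alpha$ for all $f\in C^1(\Omega)$, and $\mathrm{Var}_{\sigma_\beta}(f)\le C_{\sigma_\beta}\int_{\partial\Omega}|\nabla^\tau f|^2d\sigma_\beta$ and $\mathrm{Ent}_{\sigma_\beta}(f^2)\le L_{\sigma_\beta}\int_{\partial\Omega}|\nabla^\tau f|^2d\sigma_\beta$ for all $f\in C^1(\partial\Omega)$. (4) The following embeddings/traces hold: $W^{1,2}(\Omega,\alpha d\lambda)\to L^2(\Omega,\alpha d\lambda)$ compactly; $W^{1,2}(\Omega,\alpha d\lambda)\to L^p(\Omega,\beta d\lambda)$ for $p\in[2,\frac{2d-2}{d-2}]$; $W^{1,2}(\partial\Omega,\beta d\sigma)\to L^2(\partial\Omega,\beta d\sigma)$ compactly; the trace $W^{1,2}(\Omega,\alpha d\lambda)\to L^2(\partial\Omega,\beta d\sigma)$ compactly. $C_\mu$ is the smallest constant such that $\mathrm{Var}_\mu(f)\le C_\mu\left(\int_\Omega|\nabla f|^2\alpha\,d\lambda+\int_{\partial\Omega}|\nabla^\tau f|^2\beta\,d\sigma\right)$ for all $f\in C^1(\Omega)$. *)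

theory Defs
  imports "HOL-Probability.Probability"
begin

section \<open>Riemannian manifolds with boundary\<close>

text \<open>
  All sets \<open>S\<close> to which this is applied are relatively open in \<open>real^'k\<close>, in a closed
  half-space of it, or in \<open>{0..1}\<close>, so derivatives within \<open>S\<close> are unique and the definition means
  ``\<open>C\<^sup>k\<close> up to the boundary''.
\<close>

primrec Ck_on :: "nat \<Rightarrow> 'v::real_normed_vector set \<Rightarrow> ('v \<Rightarrow> 'w::real_normed_vector) \<Rightarrow> bool" where
  "Ck_on 0 S f \<longleftrightarrow> continuous_on S f"
| "Ck_on (Suc k) S f \<longleftrightarrow>
     (\<exists>f'. (\<forall>x\<in>S. (f has_derivative f' x) (at x within S)) \<and> (\<forall>v. Ck_on k S (\<lambda>x. f' x v)))"

definition smooth_on :: "'v::real_normed_vector set \<Rightarrow> ('v \<Rightarrow> 'w::real_normed_vector) \<Rightarrow> bool" where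
  "smooth_on S f \<longleftrightarrow> (\<forall>k. Ck_on k S f)"

text \<open>
  A chart carries, besides its domain and coordinate map, the coefficient matrix of the
  Riemannian metric with respect to its coordinate frame, as a function of the point.
\<close>

record ('a, 'k::finite) chart =
  cdom :: "'a set"
  coord :: "'a \<Rightarrow> real^'k"
  met :: "'a \<Rightarrow> real^'k^'k"

abbreviation cimg :: "('a, 'k::finite) chart \<Rightarrow> (real^'k) set" where
  "cimg c \<equiv> coord c ` cdom c"

definition in_coords :: "('a, 'k::finite) chart \<Rightarrow> ('a \<Rightarrow> 'b) \<Rightarrow> real^'k \<Rightarrow> 'b" where
  "in_coords c f = (\<lambda>x. f (inv_into (cdom c) (coord c) x))"

definition riemannian_chart ::
    "'a::topological_space set \<Rightarrow> (real^'k::finite) set \<Rightarrow> ('a, 'k) chart \<Rightarrow> bool" where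
  "riemannian_chart M H c \<longleftrightarrow>
     openin (top_of_set M) (cdom c) \<and>
     openin (top_of_set H) (cimg c) \<and>
     (\<exists>\<psi>. homeomorphism (cdom c) (cimg c) (coord c) \<psi>) \<and>
     smooth_on (cimg c) (in_coords c (met c)) \<and>
     (\<forall>p\<in>cdom c. transpose (met c p) = met c p \<and> (\<forall>v. v \<noteq> 0 \<longrightarrow> v \<bullet> (met c p *v v) > 0))"

definition transition :: "('a, 'k::finite) chart \<Rightarrow> ('a, 'k) chart \<Rightarrow> real^'k \<Rightarrow> real^'k" where
  "transition c c' = in_coords c (coord c')"

definition transition_jacobian ::
    "('a, 'k::finite) chart \<Rightarrow> ('a, 'k) chart \<Rightarrow> 'a \<Rightarrow> real^'k^'k" where
  "transition_jacobian c c' p =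
     matrix (frechet_derivative (transition c c')
       (at (coord c p) within coord c ` (cdom c \<inter> cdom c')))"

definition compatible :: "('a, 'k::finite) chart \<Rightarrow> ('a, 'k) chart \<Rightarrow> bool" where
  "compatible c c' \<longleftrightarrow>
     smooth_on (coord c ` (cdom c \<inter> cdom c')) (transition c c') \<and>
     (\<forall>p \<in> cdom c \<inter> cdom c'.
        met c p = transpose (transition_jacobian c c' p) ** met c' p ** transition_jacobian c c' p)"

text \<open>
  \<open>H\<close> is the model space: the whole of \<open>real^'k\<close> for a manifold without boundary, a closed
  half-space for a manifold with boundary.
\<close>

definition riemannian_atlas ::
    "'a::topological_space set \<Rightarrow> (real^'k::finite) set \<Rightarrow> ('a, 'k) chart set \<Rightarrow> bool" where
  "riemannian_atlas M H \<A> \<longleftrightarrow>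
     (\<forall>c\<in>\<A>. riemannian_chart M H c) \<and> (\<Union>c\<in>\<A>. cdom c) = M \<and>
     (\<forall>c\<in>\<A>. \<forall>c'\<in>\<A>. compatible c c')"

text \<open>
  The coordinates of a manifold with boundary are indexed by \<open>'m option\<close>: \<open>None\<close> is the
  coordinate transversal to the boundary, \<open>Some i\<close> are the coordinates along it. Hence the
  dimension is \<open>d = CARD('m option) = CARD('m) + 1\<close>, which ranges over all \<open>d \<ge> 2\<close>.
\<close>

definition half_space :: "(real^('m::finite option)) set" where
  "half_space = {x. 0 \<le> x $ None}"

definition compact_connected_riemannian_manifold ::
    "'a::t2_space set \<Rightarrow> ('a, 'm::finite option) chart set \<Rightarrow> bool" where
  "compact_connected_riemannian_manifold \<Omega> \<A> \<longleftrightarrow>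
     compact \<Omega> \<and> connected \<Omega> \<and> riemannian_atlas \<Omega> half_space \<A>"

definition bdry :: "('a, 'm::finite option) chart set \<Rightarrow> 'a set" where
  "bdry \<A> = {p. \<exists>c\<in>\<A>. p \<in> cdom c \<and> coord c p $ None = 0}"

definition bdry_chart :: "('a, 'm::finite option) chart \<Rightarrow> ('a, 'm) chart" where
  "bdry_chart c =
     \<lparr> cdom = {p \<in> cdom c. coord c p $ None = 0},
       coord = (\<lambda>p. \<chi> i. coord c p $ Some i),
       met = (\<lambda>p. \<chi> i j. met c p $ Some i $ Some j) \<rparr>"

text \<open>The boundary as a Riemannian manifold of dimension \<open>d - 1\<close> with the induced metric.\<close>

definition bdry_atlas :: "('a, 'm::finite option) chart set \<Rightarrow> ('a, 'm) chart set" where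
  "bdry_atlas \<A> = bdry_chart ` \<A>"

text \<open>
  This determines \<open>\<nu>\<close> uniquely when countably many charts cover \<open>M\<close>, in particular when
  \<open>M\<close> is compact.
\<close>

definition riemannian_volume ::
    "'a::topological_space set \<Rightarrow> ('a, 'k::finite) chart set \<Rightarrow> 'a measure \<Rightarrow> bool" where
  "riemannian_volume M \<A> \<nu> \<longleftrightarrow>
     sets \<nu> = sets (restrict_space borel M) \<and>
     (\<forall>c\<in>\<A>. \<forall>E\<in>sets \<nu>. E \<subseteq> cdom c \<longrightarrow>
        emeasure \<nu> E =
          (\<integral>\<^sup>+x\<in>coord c ` E. ennreal (sqrt (det (in_coords c (met c) x))) \<partial>lborel))"

text \<open>The Riemannian distance; the speed of a curve does not depend on the chart selected.\<close>

definition C1_curve :: "'a::topological_space set \<Rightarrow> ('a, 'k::finite) chart set \<Rightarrow> (real \<Rightarrow> 'a) \<Rightarrow> bool" where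
  "C1_curve M \<A> \<gamma> \<longleftrightarrow>
     continuous_on {0..1} \<gamma> \<and> \<gamma> ` {0..1} \<subseteq> M \<and>
     (\<forall>c\<in>\<A>. Ck_on 1 {t\<in>{0..1}. \<gamma> t \<in> cdom c} (\<lambda>t. coord c (\<gamma> t)))"

definition speed :: "('a, 'k::finite) chart set \<Rightarrow> (real \<Rightarrow> 'a) \<Rightarrow> real \<Rightarrow> real" where
  "speed \<A> \<gamma> t =
     (let c = (SOME c. c \<in> \<A> \<and> \<gamma> t \<in> cdom c);
          v = frechet_derivative (\<lambda>t. coord c (\<gamma> t)) (at t within {t\<in>{0..1}. \<gamma> t \<in> cdom c}) 1
      in sqrt (v \<bullet> (met c (\<gamma> t) *v v)))"

definition riemannian_dist ::
    "'a::topological_space set \<Rightarrow> ('a, 'k::finite) chart set \<Rightarrow> 'a \<Rightarrow> 'a \<Rightarrow> real" where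
  "riemannian_dist M \<A> p q =
     Inf {integral {0..1} (speed \<A> \<gamma>) | \<gamma>. C1_curve M \<A> \<gamma> \<and> \<gamma> 0 = p \<and> \<gamma> 1 = q}"

definition diam :: "('a \<Rightarrow> 'a \<Rightarrow> real) \<Rightarrow> 'a set \<Rightarrow> ennreal" where
  "diam D U = (SUP x\<in>U. SUP y\<in>U. ennreal (D x y))"

text \<open>
  The \<open>s\<close>-dimensional Hausdorff measure for \<open>s \<ge> 1\<close>, with the normalisation that makes it the
  Lebesgue measure on \<open>s\<close>-dimensional Euclidean space.
\<close>

definition hausdorff :: "('a \<Rightarrow> 'a \<Rightarrow> real) \<Rightarrow> nat \<Rightarrow> 'a set \<Rightarrow> ennreal" where
  "hausdorff D s E =
     (SUP \<delta>\<in>{0<..}. INF U\<in>{U :: nat \<Rightarrow> 'a set. (\<Union>n. U n) = E \<and> (\<forall>n. diam D (U n) < \<delta>)}.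
        (\<Sum>n. ennreal (unit_ball_vol (real s)) * (diam D (U n) / 2) ^ s))"

definition surface_measure ::
    "'a::topological_space set \<Rightarrow> ('a, 'm::finite option) chart set \<Rightarrow> 'a measure \<Rightarrow> bool" where
  "surface_measure \<Omega> \<A> \<sigma> \<longleftrightarrow>
     sets \<sigma> = sets (restrict_space borel (bdry \<A>)) \<and>
     (\<forall>E\<in>sets \<sigma>. emeasure \<sigma> E = hausdorff (riemannian_dist \<Omega> \<A>) CARD('m) E)"

section \<open>Continuously differentiable functions and gradients\<close>

definition C1 :: "('a, 'k::finite) chart set \<Rightarrow> ('a \<Rightarrow> real) set" where
  "C1 \<A> = {f. \<forall>c\<in>\<A>. Ck_on 1 (cimg c) (in_coords c f)}"

definition differential :: "('a, 'k::finite) chart \<Rightarrow> ('a \<Rightarrow> real) \<Rightarrow> 'a \<Rightarrow> real^'k" where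
  "differential c f p =
     (\<chi> i. frechet_derivative (in_coords c f) (at (coord c p) within cimg c) (axis i 1))"

definition grad :: "('a, 'k::finite) chart \<Rightarrow> ('a \<Rightarrow> real) \<Rightarrow> 'a \<Rightarrow> real^'k" where
  "grad c f p = matrix_inv (met c p) *v differential c f p"

text \<open>
  The squared Riemannian length of the gradient at \<open>p\<close>. By compatibility of the charts it does
  not depend on the chart selected. With \<open>bdry_atlas \<A>\<close> it is \<open>\<bar>\<nabla>\<^sup>\<tau> f\<bar>\<^sup>2\<close>.
\<close>

definition grad_sq :: "('a, 'k::finite) chart set \<Rightarrow> ('a \<Rightarrow> real) \<Rightarrow> 'a \<Rightarrow> real" where
  "grad_sq \<A> f p =
     (let c = (SOME c. c \<in> \<A> \<and> p \<in> cdom c) in grad c f p \<bullet> (met c p *v grad c f p))"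

section \<open>Lebesgue and weighted Sobolev spaces\<close>

abbreviation weighted :: "('a \<Rightarrow> real) \<Rightarrow> 'a measure \<Rightarrow> 'a measure" where
  "weighted w \<nu> \<equiv> density \<nu> (\<lambda>x. ennreal (w x))"

definition Lp :: "real \<Rightarrow> 'a measure \<Rightarrow> ('a \<Rightarrow> real) set" where
  "Lp p \<nu> = {f \<in> borel_measurable \<nu>. integrable \<nu> (\<lambda>x. \<bar>f x\<bar> powr p)}"

definition Lp_norm :: "real \<Rightarrow> 'a measure \<Rightarrow> ('a \<Rightarrow> real) \<Rightarrow> real" where
  "Lp_norm p \<nu> f = (\<integral>x. \<bar>f x\<bar> powr p \<partial>\<nu>) powr (1 / p)"

definition C1_norm :: "('a, 'k::finite) chart set \<Rightarrow> 'a measure \<Rightarrow> ('a \<Rightarrow> real) \<Rightarrow> real" where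
  "C1_norm \<A> \<nu> f = sqrt ((\<integral>x. (f x)\<^sup>2 \<partial>\<nu>) + (\<integral>x. grad_sq \<A> f x \<partial>\<nu>))"

text \<open>
  For a degenerate weight an element of \<open>L\<^sup>2\<close> need not be locally integrable, so weak derivatives
  are not available; \<open>W\<^sup>1\<^sup>,\<^sup>2(\<nu>)\<close> is the completion of the \<open>C\<^sup>1\<close> functions in the \<open>W\<^sup>1\<^sup>,\<^sup>2\<close>-norm, realised
  inside \<open>L\<^sup>2(\<nu>)\<close>. If the gradient is closable on \<open>L\<^sup>2(\<nu>)\<close> (for a weight whose square root
  lies in the unweighted \<open>W\<^sup>1\<^sup>,\<^sup>2\<close> this follows by integration by parts), the set in \<open>W12_norm\<close> has exactly one element for each \<open>u\<close> in \<open>W\<^sup>1\<^sup>,\<^sup>2(\<nu>)\<close>.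
  For the volume measure this is the usual Sobolev space.
\<close>

definition sobolev_approx ::
    "('a, 'k::finite) chart set \<Rightarrow> 'a measure \<Rightarrow> (nat \<Rightarrow> 'a \<Rightarrow> real) \<Rightarrow> ('a \<Rightarrow> real) \<Rightarrow> bool" where
  "sobolev_approx \<A> \<nu> F u \<longleftrightarrow>
     (\<forall>n. F n \<in> C1 \<A>) \<and>
     (\<forall>\<epsilon>>0. \<exists>N. \<forall>m\<ge>N. \<forall>n\<ge>N. C1_norm \<A> \<nu> (\<lambda>x. F m x - F n x) < \<epsilon>) \<and>
     (\<lambda>n. Lp_norm 2 \<nu> (\<lambda>x. F n x - u x)) \<longlonglongrightarrow> 0"

definition W12 :: "('a, 'k::finite) chart set \<Rightarrow> 'a measure \<Rightarrow> ('a \<Rightarrow> real) set" where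
  "W12 \<A> \<nu> = {u \<in> Lp 2 \<nu>. \<exists>F. sobolev_approx \<A> \<nu> F u}"

definition W12_norm :: "('a, 'k::finite) chart set \<Rightarrow> 'a measure \<Rightarrow> ('a \<Rightarrow> real) \<Rightarrow> real" where
  "W12_norm \<A> \<nu> u =
     Inf {l. \<exists>F. sobolev_approx \<A> \<nu> F u \<and> (\<lambda>n. C1_norm \<A> \<nu> (F n)) \<longlonglongrightarrow> l}"

definition continuously_embedded ::
    "('a, 'k::finite) chart set \<Rightarrow> 'a measure \<Rightarrow> real \<Rightarrow> 'a measure \<Rightarrow> bool" where
  "continuously_embedded \<A> \<nu> p \<kappa> \<longleftrightarrow>
     (\<exists>C. \<forall>u\<in>W12 \<A> \<nu>. u \<in> Lp p \<kappa> \<and> Lp_norm p \<kappa> u \<le> C * W12_norm \<A> \<nu> u)"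

definition compact_into_L2 ::
    "('a, 'k::finite) chart set \<Rightarrow> 'a measure \<Rightarrow> (('a \<Rightarrow> real) \<Rightarrow> 'a \<Rightarrow> real) \<Rightarrow> 'a measure \<Rightarrow> bool" where
  "compact_into_L2 \<A> \<nu> T \<kappa> \<longleftrightarrow>
     (\<forall>u\<in>W12 \<A> \<nu>. T u \<in> Lp 2 \<kappa>) \<and>
     (\<forall>u :: nat \<Rightarrow> 'a \<Rightarrow> real.
        (\<forall>n. u n \<in> W12 \<A> \<nu>) \<and> bounded (range (\<lambda>n. W12_norm \<A> \<nu> (u n))) \<longrightarrow>
        (\<exists>r v. strict_mono r \<and> v \<in> Lp 2 \<kappa> \<and>
           (\<lambda>n. Lp_norm 2 \<kappa> (\<lambda>x. T (u (r n)) x - v x)) \<longlonglongrightarrow> 0))"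

text \<open>
  The trace is the continuous linear extension of the restriction of \<open>C\<^sup>1\<close> functions; a linear
  operator that is compact is continuous, so these conditions determine it.
\<close>

definition compact_trace ::
    "('a, 'k::finite) chart set \<Rightarrow> 'a measure \<Rightarrow> 'a measure \<Rightarrow> bool" where
  "compact_trace \<A> \<nu> \<kappa> \<longleftrightarrow>
     (\<exists>T. (\<forall>f \<in> C1 \<A>. AE x in \<kappa>. T f x = f x) \<and>
        (\<forall>u\<in>W12 \<A> \<nu>. \<forall>v\<in>W12 \<A> \<nu>. \<forall>a b.
           AE x in \<kappa>. T (\<lambda>y. a * u y + b * v y) x = a * T u x + b * T v x) \<and>
        compact_into_L2 \<A> \<nu> T \<kappa>)"

section \<open>Functional inequalities\<close>

definition Var :: "'a measure \<Rightarrow> ('a \<Rightarrow> real) \<Rightarrow> real" where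
  "Var \<nu> f = (\<integral>x. (f x)\<^sup>2 \<partial>\<nu>) - (\<integral>x. f x \<partial>\<nu>)\<^sup>2"

text \<open>\<open>Ent_sq \<nu> f\<close> is the entropy of \<open>f\<^sup>2\<close>; at zeros of \<open>f\<close> the integrand is \<open>0\<close>.\<close>

definition Ent_sq :: "'a measure \<Rightarrow> ('a \<Rightarrow> real) \<Rightarrow> real" where
  "Ent_sq \<nu> f =
     (\<integral>x. (f x)\<^sup>2 * ln ((f x)\<^sup>2) \<partial>\<nu>) - (\<integral>x. (f x)\<^sup>2 \<partial>\<nu>) * ln (\<integral>x. (f x)\<^sup>2 \<partial>\<nu>)"

text \<open>The smallest constant \<open>C\<close> with \<open>V f \<le> C * E f\<close> on \<open>F\<close>; it is \<open>\<infinity>\<close> if there is none.\<close>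

definition best_const ::
    "('a \<Rightarrow> real) set \<Rightarrow> (('a \<Rightarrow> real) \<Rightarrow> real) \<Rightarrow> (('a \<Rightarrow> real) \<Rightarrow> real) \<Rightarrow> ereal" where
  "best_const F V E = Inf (ereal ` {C. \<forall>f\<in>F. V f \<le> C * E f})"

text \<open>The measure \<open>\<alpha> d\<Lambda> + \<beta> d\<sigma>\<close> on \<open>\<Omega>\<close>, where \<open>\<sigma>\<close> lives on the subset \<open>\<Gamma>\<close> of \<open>\<Omega>\<close>.\<close>

definition sticky_measure ::
    "'a set \<Rightarrow> 'a set \<Rightarrow> ('a \<Rightarrow> real) \<Rightarrow> 'a measure \<Rightarrow> ('a \<Rightarrow> real) \<Rightarrow> 'a measure \<Rightarrow> 'a measure" where
  "sticky_measure \<Omega> \<Gamma> \<alpha> \<Lambda> \<beta> \<sigma> =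
     measure_of \<Omega> (sets \<Lambda>)
       (\<lambda>E. emeasure (weighted \<alpha> \<Lambda>) E + emeasure (weighted \<beta> \<sigma>) (E \<inter> \<Gamma>))"

end

theory Submission
  imports Defs
begin

text \<open>
  The measure \<open>\<mu>\<close> is the mixture \<open>A \<Lambda>\<^sub>\<alpha> + B \<sigma>\<^sub>\<beta>\<close>, so the variance of a \<open>C\<^sup>1\<close> function \<open>f\<close> under \<open>\<mu>\<close>
  is \<open>A Var \<Lambda>\<^sub>\<alpha> f + B Var \<sigma>\<^sub>\<beta> f\<close> plus \<open>A B\<close> times the squared difference of the two means
  (\<open>Var_mixture\<close>). Let \<open>a\<close> and \<open>b\<close> be the interior and the boundary energy of \<open>f\<close>, taken against
  \<open>\<Lambda>\<^sub>\<alpha>\<close> and \<open>\<sigma>\<^sub>\<beta>\<close>. The Poincare inequality in the interior and the assumed bound on the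
  difference of the means give
  \<open>Var \<mu> f \<le> (C\<^sub>\<Lambda> + B K\<^sub>1) A a + (A K\<^sub>2) B b + B Var \<sigma>\<^sub>\<beta> f\<close>.
  The last term can be charged either to the interior, as \<open>B Var \<sigma>\<^sub>\<beta> f \<le> (B / A) K\<^sub>\<Gamma> A a\<close>, or to
  the boundary, as \<open>B Var \<sigma>\<^sub>\<beta> f \<le> C\<^sub>\<sigma> B b\<close>. Taking the convex combination of the two bounds that
  equalises the factors of \<open>A a\<close> and \<open>B b\<close> produces the quotient in the theorem
  (\<open>interpolate_two_bounds\<close>).

  The rest is analysis that makes these computations legitimate. A \<open>C\<^sup>1\<close> function is continuous
  on the compact \<open>\<Omega>\<close>, hence bounded, so its moments are finite and additive over the
  two parts of \<open>\<mu>\<close> (\<open>C1_continuous_on\<close>, \<open>integral_sticky\<close>), and its restriction to the boundary is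
  again \<open>C\<^sup>1\<close> (\<open>C1_restrict_bdry\<close>). Energies are nonnegative because metrics are positive definite, and
  \<open>A a + B b\<close> is at most the energy belonging to \<open>\<mu>\<close> (\<open>integral_normalised_density_le\<close>).
\<close>

section \<open>Sharp constants\<close>

text \<open>The set of admissible constants is closed, so the infimum that defines the sharp constant
  may itself be used.\<close>

lemma sharp_constant_is_admissible:
  assumes sharp: "best_const F V E = ereal C" and f: "f \<in> F" and nonneg: "0 \<le> E f"
  shows "V f \<le> C * E f"
proof (rule field_le_epsilon)
  fix e :: real assume "0 < e"
  define \<delta> where "\<delta> = e / (E f + 1)"
  have "0 < \<delta>" using \<open>0 < e\<close> nonneg by (simp add: \<delta>_def)
  then have "Inf (ereal ` {C. \<forall>f\<in>F. V f \<le> C * E f}) < ereal (C + \<delta>)"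
    using sharp by (simp add: best_const_def)
  then obtain C' where C': "\<forall>f\<in>F. V f \<le> C' * E f" "C' < C + \<delta>"
    by (auto simp: Inf_less_iff)
  have "V f \<le> C' * E f" using C' f by blast
  also have "\<dots> \<le> (C + \<delta>) * E f" using C' nonneg by (intro mult_right_mono) auto
  also have "\<delta> * E f \<le> e"
    using \<open>0 < e\<close> nonneg by (simp add: \<delta>_def field_simps)
  then have "(C + \<delta>) * E f \<le> C * E f + e" by (simp add: algebra_simps)
  finally show "V f \<le> C * E f + e" .
qed

text \<open>If the energy vanished identically, either every constant or no constant would be
  admissible, so the sharp constant would be infinite.\<close>

lemma finite_sharp_constant_nonzero_energy:
  assumes "best_const F V E = ereal C"
  shows "\<exists>f\<in>F. E f \<noteq> 0"
proof (rule ccontr)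
  assume "\<not> ?thesis"
  then have all_or_none: "(\<forall>f\<in>F. V f \<le> C' * E f) \<longleftrightarrow> (\<forall>f\<in>F. V f \<le> 0)" for C' by auto
  show False
  proof (cases "\<forall>f\<in>F. V f \<le> 0")
    case True
    then have "ereal (C - 1) \<in> ereal ` {C. \<forall>f\<in>F. V f \<le> C * E f}" unfolding all_or_none by simp
    then have "best_const F V E \<le> ereal (C - 1)" unfolding best_const_def by (rule Inf_lower)
    then show False using assms by simp
  next
    case False
    then have "{C. \<forall>f\<in>F. V f \<le> C * E f} = {}" using all_or_none by blast
    then have "best_const F V E = Inf {}" unfolding best_const_def by (simp only: image_empty)
    then show False using assms by (simp add: top_ereal_def)
  qed
qed

section \<open>Optimal splitting of the boundary variance\<close>

text \<open>
  Bounding \<open>z\<close> by \<open>t * k * u + (1 - t) * C * w\<close> gives the factor \<open>max (P + t * k) (Q + (1 - t) * C)\<close>.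
  The two entries agree at \<open>t = (Q + C - P) / (k + C)\<close>, where they equal the quotient
  below; if this \<open>t\<close> leaves the unit interval, the nearer endpoint gives \<open>P\<close> or \<open>Q\<close>.
  The constants \<open>k\<close> and \<open>C\<close> may have any sign: unless \<open>z = 0\<close>, in which case there is nothing to split,
  both are positive.
\<close>

lemma interpolate_two_bounds:
  fixes P Q k C u w z :: real
  assumes "0 \<le> u" "0 \<le> w" "0 \<le> z" "z \<le> k * u" "z \<le> C * w"
  shows "P * u + Q * w + z \<le> Max {P, Q, (k * (C + Q) + P * C) / (k + C)} * (u + w)"
    (is "_ \<le> ?M * (u + w)")
proof -
  define R where "R = (k * (C + Q) + P * C) / (k + C)"
  define M where "M = ?M"
  have M: "P \<le> M" "Q \<le> M" "R \<le> M" by (auto simp: M_def R_def)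
  have split: "P * u + Q * w + z \<le> M * (u + w)"
    if t: "0 \<le> t" "t \<le> 1" and "P + t * k \<le> M" "Q + (1 - t) * C \<le> M" for t
  proof -
    have "z = t * z + (1 - t) * z" by (simp add: algebra_simps)
    also have "\<dots> \<le> t * (k * u) + (1 - t) * (C * w)"
      using assms t by (intro add_mono mult_left_mono) auto
    finally have "P * u + Q * w + z \<le> (P + t * k) * u + (Q + (1 - t) * C) * w"
      by (simp add: algebra_simps)
    also have "\<dots> \<le> M * u + M * w"
      using assms that by (intro add_mono mult_right_mono) auto
    finally show ?thesis by (simp add: algebra_simps)
  qed
  have z0: "P * u + Q * w + z \<le> M * (u + w)" if "z = 0"
    using mult_right_mono[OF M(1) assms(1)] mult_right_mono[OF M(2) assms(2)] that
    by (simp add: algebra_simps)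
  show ?thesis
  proof (cases "z = 0")
    case True
    then show ?thesis using z0 by (simp add: M_def)
  next
    case False
    then have "0 < k * u" "0 < C * w" using assms by linarith+
    then have kC: "0 < k" "0 < C" using assms by (auto simp: zero_less_mult_iff)
    define t where "t = (Q + C - P) / (k + C)"
    have tk: "t * (k + C) = Q + C - P" using kC by (simp add: t_def)
    consider "t < 0" | "1 < t" | "0 \<le> t" "t \<le> 1" by linarith
    then have "P * u + Q * w + z \<le> M * (u + w)"
    proof cases
      case 1
      then have "Q + C - P < 0" using kC by (simp add: t_def divide_less_0_iff)
      then show ?thesis using M by (intro split[of 0]) auto
    next
      case 2
      then have "k + C < Q + C - P" using kC by (simp add: t_def field_simps)
      then show ?thesis using M by (intro split[of 1]) auto
    next
      case 3
      have "(P + t * k) * (k + C) = P * (k + C) + k * (t * (k + C))"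
        by (simp add: algebra_simps)
      also have "\<dots> = k * (C + Q) + P * C" unfolding tk by (simp add: algebra_simps)
      finally have "P + t * k = R" using kC unfolding R_def by (intro eq_divide_imp) auto
      moreover have "Q + (1 - t) * C = P + t * k" using tk by (simp add: algebra_simps)
      ultimately show ?thesis using 3 M by (intro split[of t]) auto
    qed
    then show ?thesis by (simp add: M_def)
  qed
qed

section \<open>Normalised densities and variances\<close>

lemma prob_space_normalised_density:
  fixes w :: "'a \<Rightarrow> real"
  assumes "0 < (\<integral>x. w x \<partial>\<nu>)" and "AE x in \<nu>. 0 < w x"
  shows "prob_space (weighted (\<lambda>x. w x / (\<integral>x. w x \<partial>\<nu>)) \<nu>)"
proof (rule prob_spaceI)
  let ?c = "\<integral>x. w x \<partial>\<nu>"
  have int: "integrable \<nu> w" using assms not_integrable_integral_eq by force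
  then have [measurable]: "w \<in> borel_measurable \<nu>" by simp
  have "emeasure (weighted (\<lambda>x. w x / ?c) \<nu>) (space \<nu>) = (\<integral>\<^sup>+x. ennreal (w x / ?c) \<partial>\<nu>)"
    by (subst emeasure_density) (auto intro!: nn_integral_cong)
  also have "\<dots> = ennreal (\<integral>x. w x / ?c \<partial>\<nu>)"
    using int assms by (intro nn_integral_eq_integral) auto
  also have "\<dots> = 1" using assms by simp
  finally show "emeasure (weighted (\<lambda>x. w x / ?c) \<nu>)
      (space (weighted (\<lambda>x. w x / ?c) \<nu>)) = 1" by simp
qed

lemma integral_normalised_density:
  fixes w g :: "'a \<Rightarrow> real"
  assumes "0 < c" and "w \<in> borel_measurable \<nu>" and "AE x in \<nu>. 0 < w x"
    and "g \<in> borel_measurable \<nu>"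
  shows "c * (\<integral>x. g x \<partial>(weighted (\<lambda>x. w x / c) \<nu>)) = (\<integral>x. g x * w x \<partial>\<nu>)"
proof -
  have "(\<integral>x. g x \<partial>(weighted (\<lambda>x. w x / c) \<nu>)) = (\<integral>x. (w x / c) * g x \<partial>\<nu>)"
    using assms by (subst integral_density) auto
  also have "\<dots> = (\<integral>x. g x * w x \<partial>\<nu>) / c"
    by (simp flip: integral_divide_zero add: mult.commute)
  finally show ?thesis using assms by simp
qed

text \<open>
  Only an inequality is claimed, so that \<open>g\<close> may be non-measurable: its integral against the
  density is then \<open>0\<close> by convention. Energy densities, defined with an arbitrary choice of chart
  at every point, can therefore be used without proving them measurable.
\<close>

lemma integral_normalised_density_le:
  fixes w g :: "'a \<Rightarrow> real"
  assumes "0 < c" and "w \<in> borel_measurable \<nu>" and "AE x in \<nu>. 0 < w x"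
    and "\<And>x. x \<in> space \<nu> \<Longrightarrow> 0 \<le> g x"
  shows "c * (\<integral>x. g x \<partial>(weighted (\<lambda>x. w x / c) \<nu>)) \<le> (\<integral>x. g x * w x \<partial>\<nu>)"
proof (cases "g \<in> borel_measurable \<nu>")
  case True
  then show ?thesis using integral_normalised_density[of c w \<nu> g] assms by simp
next
  case False
  then have "\<not> integrable (weighted (\<lambda>x. w x / c) \<nu>) g"
    by (auto dest: borel_measurable_integrable)
  then have "(\<integral>x. g x \<partial>(weighted (\<lambda>x. w x / c) \<nu>)) = 0" by (rule not_integrable_integral_eq)
  moreover have "0 \<le> (\<integral>x. g x * w x \<partial>\<nu>)"
    using assms by (intro integral_nonneg_AE) auto
  ultimately show ?thesis by simp
qed

lemma integrable_unnormalised_density: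
  fixes w g :: "'a \<Rightarrow> real"
  assumes "0 < c" and "w \<in> borel_measurable \<nu>" and "AE x in \<nu>. 0 < w x"
    and "g \<in> borel_measurable \<nu>" and "integrable (weighted (\<lambda>x. w x / c) \<nu>) g"
  shows "integrable (weighted w \<nu>) g"
proof -
  have nonneg: "AE x in \<nu>. 0 \<le> w x" "AE x in \<nu>. 0 \<le> w x / c" using assms(1,3) by auto
  have "integrable \<nu> (\<lambda>x. (w x / c) * g x)"
    using assms nonneg integrable_density[of g \<nu> "\<lambda>x. w x / c"] by simp
  from integrable_mult_right[OF this, of c] have "integrable \<nu> (\<lambda>x. w x * g x)"
    using assms(1) by simp
  then show ?thesis using assms nonneg integrable_density[of g \<nu> w] by simp
qed

lemma (in prob_space) Var_nonneg:
  assumes "integrable M f" and "integrable M (\<lambda>x. (f x)\<^sup>2)"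
  shows "0 \<le> Var M f"
  using variance_eq[OF assms] variance_positive[of f] by (simp add: Var_def)

text \<open>The law of total variance for a mixture: the last term is the variance of the conditional
  mean, which takes two values with the weights \<open>A\<close> and \<open>B\<close>.\<close>

lemma Var_mixture:
  fixes A B :: real
  assumes "A + B = 1"
    and "(\<integral>x. f x \<partial>\<mu>) = A * (\<integral>x. f x \<partial>\<nu>) + B * (\<integral>x. f x \<partial>\<kappa>)"
    and "(\<integral>x. (f x)\<^sup>2 \<partial>\<mu>) = A * (\<integral>x. (f x)\<^sup>2 \<partial>\<nu>) + B * (\<integral>x. (f x)\<^sup>2 \<partial>\<kappa>)"
  shows "Var \<mu> f = A * Var \<nu> f + B * Var \<kappa> f + A * B * ((\<integral>x. f x \<partial>\<nu>) - (\<integral>x. f x \<partial>\<kappa>))\<^sup>2"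
proof -
  have B: "B = 1 - A" using assms(1) by simp
  show ?thesis
    unfolding Var_def assms(2,3) B by (simp add: power2_eq_square algebra_simps)
qed

section \<open>Integration against the sticky measure\<close>

locale measure_with_boundary_part =
  fixes \<Omega> \<Gamma> :: "'a set" and \<alpha> \<beta> :: "'a \<Rightarrow> real" and \<Lambda> \<sigma> :: "'a measure"
  assumes space_interior: "space \<Lambda> = \<Omega>"
    and trace_sets: "\<And>E. E \<in> sets \<Lambda> \<Longrightarrow> E \<inter> \<Gamma> \<in> sets \<sigma>"
    and space_boundary: "space \<sigma> = \<Gamma>" and subset: "\<Gamma> \<subseteq> \<Omega>"
begin

abbreviation "sticky \<equiv> sticky_measure \<Omega> \<Gamma> \<alpha> \<Lambda> \<beta> \<sigma>"

lemma sets_sticky [simp, measurable_cong]: "sets sticky = sets \<Lambda>"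
  unfolding sticky_measure_def space_interior[symmetric] by (simp add: sets.sets_measure_of_eq)

lemma space_sticky [simp]: "space sticky = \<Omega>"
  using sets_eq_imp_space_eq[OF sets_sticky] space_interior by simp

lemma emeasure_sticky:
  assumes "E \<in> sets \<Lambda>"
  shows "emeasure sticky E = emeasure (weighted \<alpha> \<Lambda>) E + emeasure (weighted \<beta> \<sigma>) (E \<inter> \<Gamma>)"
  unfolding sticky_measure_def
proof (rule emeasure_measure_of_sigma)
  show "sigma_algebra \<Omega> (sets \<Lambda>)" using sets.sigma_algebra_axioms[of \<Lambda>] space_interior by simp
  show "positive (sets \<Lambda>) (\<lambda>E. emeasure (weighted \<alpha> \<Lambda>) E + emeasure (weighted \<beta> \<sigma>) (E \<inter> \<Gamma>))"
    by (simp add: positive_def)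
  show "countably_additive (sets \<Lambda>)
      (\<lambda>E. emeasure (weighted \<alpha> \<Lambda>) E + emeasure (weighted \<beta> \<sigma>) (E \<inter> \<Gamma>))"
  proof (rule countably_additiveI)
    fix D :: "nat \<Rightarrow> 'a set"
    assume D: "range D \<subseteq> sets \<Lambda>" "disjoint_family D"
    have "(\<Sum>i. emeasure (weighted \<alpha> \<Lambda>) (D i)) = emeasure (weighted \<alpha> \<Lambda>) (\<Union>i. D i)"
      using D by (intro suminf_emeasure) auto
    moreover have "(\<Sum>i. emeasure (weighted \<beta> \<sigma>) (D i \<inter> \<Gamma>)) = emeasure (weighted \<beta> \<sigma>) (\<Union>i. D i \<inter> \<Gamma>)"
      using D trace_sets by (intro suminf_emeasure) (auto simp: disjoint_family_on_def)
    moreover have "(\<Union>i. D i \<inter> \<Gamma>) = (\<Union>i. D i) \<inter> \<Gamma>" by auto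
    ultimately show "(\<Sum>i. emeasure (weighted \<alpha> \<Lambda>) (D i) + emeasure (weighted \<beta> \<sigma>) (D i \<inter> \<Gamma>))
        = emeasure (weighted \<alpha> \<Lambda>) (\<Union>i. D i) + emeasure (weighted \<beta> \<sigma>) ((\<Union>i. D i) \<inter> \<Gamma>)"
      by (simp add: suminf_add[symmetric])
  qed
  show "E \<in> sets \<Lambda>" by fact
qed

lemma measurable_on_boundary:
  assumes "f \<in> measurable \<Lambda> N"
  shows "f \<in> measurable \<sigma> N"
proof -
  have "(\<lambda>x. x) \<in> measurable \<sigma> \<Lambda>"
  proof (rule measurableI)
    show "x \<in> space \<Lambda>" if "x \<in> space \<sigma>" for x
      using that subset space_boundary space_interior by auto
    show "(\<lambda>x. x) -` E \<inter> space \<sigma> \<in> sets \<sigma>" if "E \<in> sets \<Lambda>" for E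
      using trace_sets[OF that] space_boundary by simp
  qed
  from measurable_compose[OF this assms] show ?thesis .
qed

lemma nn_integral_sticky:
  assumes "f \<in> borel_measurable \<Lambda>"
  shows "(\<integral>\<^sup>+x. f x \<partial>sticky) = (\<integral>\<^sup>+x. f x \<partial>weighted \<alpha> \<Lambda>) + (\<integral>\<^sup>+x. f x \<partial>weighted \<beta> \<sigma>)"
  using assms
proof (induction f rule: borel_measurable_induct)
  case (cong f g)
  have "(\<integral>\<^sup>+x. f x \<partial>N) = (\<integral>\<^sup>+x. g x \<partial>N)" if "space N \<subseteq> \<Omega>" for N
    using cong(3) that space_interior by (intro nn_integral_cong) auto
  from this[of sticky] this[of "weighted \<alpha> \<Lambda>"] this[of "weighted \<beta> \<sigma>"] cong(4) show ?case
    using subset by (simp add: space_interior space_boundary)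
next
  case (set E)
  have "(\<integral>\<^sup>+x. indicator E x \<partial>weighted \<beta> \<sigma>) = (\<integral>\<^sup>+x. indicator (E \<inter> \<Gamma>) x \<partial>weighted \<beta> \<sigma>)"
    by (intro nn_integral_cong) (auto simp: indicator_def space_boundary)
  then show ?case using set trace_sets[OF set] by (simp add: emeasure_sticky)
next
  case (mult u c)
  then show ?case using measurable_on_boundary[OF mult(2)]
    by (simp add: nn_integral_cmult distrib_left)
next
  case (add u v)
  then show ?case using measurable_on_boundary[OF add(1)] measurable_on_boundary[OF add(3)]
    by (simp add: nn_integral_add add.IH ac_simps)
next
  case (seq U)
  have [measurable]: "U i \<in> borel_measurable \<Lambda>" "U i \<in> borel_measurable \<sigma>" for i
    using seq(1) measurable_on_boundary by auto
  have inc: "incseq (\<lambda>i. \<integral>\<^sup>+x. U i x \<partial>N)" for N :: "'a measure"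
    using seq(3) by (auto simp: incseq_def le_fun_def intro!: nn_integral_mono)
  have "(\<integral>\<^sup>+x. (SUP i. U i x) \<partial>N) = (SUP i. \<integral>\<^sup>+x. U i x \<partial>N)"
    if "\<And>i. U i \<in> borel_measurable N" for N
    using that seq(3) by (intro nn_integral_monotone_convergence_SUP) auto
  then show ?case
    by (simp add: seq.IH SUP_apply image_comp ennreal_SUP_add[OF inc inc])
qed

text \<open>Integrability is required against both parts separately: the Bochner integral of a
  non-integrable function is \<open>0\<close>, and additivity would fail.\<close>

lemma integral_sticky:
  fixes f :: "'a \<Rightarrow> real"
  assumes "f \<in> borel_measurable \<Lambda>"
    and "integrable (weighted \<alpha> \<Lambda>) f" and "integrable (weighted \<beta> \<sigma>) f"
  shows "(\<integral>x. f x \<partial>sticky) = (\<integral>x. f x \<partial>weighted \<alpha> \<Lambda>) + (\<integral>x. f x \<partial>weighted \<beta> \<sigma>)"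
proof -
  have split: "(\<integral>\<^sup>+x. ennreal (g x) \<partial>sticky) =
      (\<integral>\<^sup>+x. ennreal (g x) \<partial>weighted \<alpha> \<Lambda>) + (\<integral>\<^sup>+x. ennreal (g x) \<partial>weighted \<beta> \<sigma>)"
    if "g \<in> borel_measurable \<Lambda>" for g :: "'a \<Rightarrow> real"
    using that by (intro nn_integral_sticky) auto
  have fin: "(\<integral>\<^sup>+x. ennreal (s * f x) \<partial>N) < \<top>" if "integrable N f" for s and N :: "'a measure"
  proof -
    have "integrable N (\<lambda>x. s * f x)" using that by simp
    then have "(\<integral>\<^sup>+x. ennreal (norm (s * f x)) \<partial>N) < \<infinity>" by (metis integrable_iff_bounded)
    moreover have "(\<integral>\<^sup>+x. ennreal (s * f x) \<partial>N) \<le> (\<integral>\<^sup>+x. ennreal (norm (s * f x)) \<partial>N)"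
      by (intro nn_integral_mono ennreal_leI) auto
    ultimately show ?thesis by (simp add: le_less_trans)
  qed
  note fins = fin[OF assms(2), of 1] fin[OF assms(3), of 1]
    fin[OF assms(2), of "-1"] fin[OF assms(3), of "-1"]
  have "integrable sticky f"
  proof (rule integrableI_bounded)
    show "f \<in> borel_measurable sticky" using assms(1) by simp
    have "(\<integral>\<^sup>+x. ennreal (norm (f x)) \<partial>weighted \<alpha> \<Lambda>) < \<infinity>"
      "(\<integral>\<^sup>+x. ennreal (norm (f x)) \<partial>weighted \<beta> \<sigma>) < \<infinity>"
      using assms by (auto simp: integrable_iff_bounded)
    then show "(\<integral>\<^sup>+x. ennreal (norm (f x)) \<partial>sticky) < \<infinity>"
      using assms(1) by (subst split) auto
  qed
  then show ?thesis
    using assms fins split[OF assms(1)] split[of "\<lambda>x. - f x"]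
    by (simp add: real_lebesgue_integral_def enn2real_plus)
qed

end

section \<open>Geometry of the charts\<close>

lemma sq_length_nonneg:
  fixes G :: "real^'k^'k"
  assumes "\<forall>v. v \<noteq> 0 \<longrightarrow> v \<bullet> (G *v v) > 0"
  shows "0 \<le> v \<bullet> (G *v v)"
  using assms by (cases "v = 0") (auto intro: less_imp_le)

lemma grad_sq_nonneg:
  assumes pos: "\<And>c. c \<in> \<A> \<Longrightarrow> p \<in> cdom c \<Longrightarrow> \<forall>v. v \<noteq> 0 \<longrightarrow> v \<bullet> (met c p *v v) > 0"
    and covered: "p \<in> (\<Union>c\<in>\<A>. cdom c)"
  shows "0 \<le> grad_sq \<A> f p"
proof -
  define c where "c = (SOME c. c \<in> \<A> \<and> p \<in> cdom c)"
  have "c \<in> \<A> \<and> p \<in> cdom c" unfolding c_def by (rule someI_ex) (use covered in blast)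
  then show ?thesis
    using sq_length_nonneg[OF pos, of c] by (simp add: grad_sq_def Let_def c_def)
qed

text \<open>The coordinate form of the inclusion of the boundary hyperplane into the half-space.\<close>

definition hyperplane_embedding :: "real^'m \<Rightarrow> real^('m::finite option)" where
  "hyperplane_embedding y = (\<chi> j. case j of None \<Rightarrow> 0 | Some i \<Rightarrow> y $ i)"

lemma bounded_linear_hyperplane_embedding: "bounded_linear hyperplane_embedding"
  by (intro linear_conv_bounded_linear[THEN iffD1] linearI)
     (auto simp: hyperplane_embedding_def vec_eq_iff split: option.split)

lemma sum_option:
  fixes h :: "'m::finite option \<Rightarrow> real"
  shows "(\<Sum>j\<in>UNIV. h j) = h None + (\<Sum>i\<in>UNIV. h (Some i))"
proof -
  have "(\<Sum>j\<in>UNIV. h j) = h None + sum h (range Some)"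
    by (simp add: UNIV_option_conv)
  then show ?thesis by (simp add: sum.reindex)
qed

text \<open>The induced metric evaluates the ambient metric on vectors tangent to the boundary.\<close>

lemma bdry_metric_pos:
  fixes c :: "('a, 'm::finite option) chart"
  assumes pos: "\<forall>v. v \<noteq> 0 \<longrightarrow> v \<bullet> (met c p *v v) > 0"
  shows "\<forall>v. v \<noteq> 0 \<longrightarrow> v \<bullet> (met (bdry_chart c) p *v v) > 0"
proof (intro allI impI)
  fix v :: "real^'m" assume "v \<noteq> 0"
  then have "hyperplane_embedding v \<noteq> 0"
    by (auto simp: hyperplane_embedding_def vec_eq_iff) (metis option.simps(5))
  then have "hyperplane_embedding v \<bullet> (met c p *v hyperplane_embedding v) > 0"
    using pos by blast
  then show "v \<bullet> (met (bdry_chart c) p *v v) > 0"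
    by (simp add: bdry_chart_def inner_vec_def matrix_vector_mult_def sum_option
        hyperplane_embedding_def)
qed

lemma homeomorphism_imp_inj_on: "homeomorphism S T h g \<Longrightarrow> inj_on h S"
  by (rule inj_on_inverseI) (rule homeomorphism_apply1)

text \<open>Continuity is known on each chart domain, and passes to \<open>M\<close> because these are open in \<open>M\<close>.\<close>

lemma C1_continuous_on:
  assumes charts: "\<forall>c\<in>\<A>. riemannian_chart M H c" and cover: "(\<Union>c\<in>\<A>. cdom c) = M"
    and f: "f \<in> C1 \<A>"
  shows "continuous_on M f"
proof -
  have cont: "continuous_on (cdom c) f" if "c \<in> \<A>" for c
  proof -
    from charts that obtain \<psi> where hom: "homeomorphism (cdom c) (cimg c) (coord c) \<psi>"
      unfolding riemannian_chart_def by blast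
    from f that obtain f' where
      "\<forall>x\<in>cimg c. (in_coords c f has_derivative f' x) (at x within cimg c)"
      unfolding C1_def One_nat_def by auto
    then have "continuous_on (cimg c) (in_coords c f)"
      by (auto simp: continuous_on_eq_continuous_within intro: has_derivative_continuous)
    then have "continuous_on (cdom c) (in_coords c f \<circ> coord c)"
      using hom by (intro continuous_on_compose) (auto simp: homeomorphism_def)
    moreover have "(in_coords c f \<circ> coord c) p = f p" if "p \<in> cdom c" for p
      using homeomorphism_imp_inj_on[OF hom] that by (simp add: in_coords_def)
    ultimately show ?thesis by (rule continuous_on_eq)
  qed
  show ?thesis
    unfolding continuous_openin_preimage_eq
  proof (intro allI impI)
    fix T :: "real set" assume "open T"
    then have "openin (top_of_set M) (cdom c \<inter> f -` T)" if "c \<in> \<A>" for c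
      using cont[OF that] charts that openin_trans
      unfolding continuous_openin_preimage_eq riemannian_chart_def by blast
    then have "openin (top_of_set M) (\<Union>c\<in>\<A>. cdom c \<inter> f -` T)" by blast
    moreover have "(\<Union>c\<in>\<A>. cdom c \<inter> f -` T) = M \<inter> f -` T" using cover by blast
    ultimately show "openin (top_of_set M) (M \<inter> f -` T)" by simp
  qed
qed

text \<open>In boundary coordinates \<open>f\<close> is its ambient coordinate form composed with the linear
  hyperplane embedding, so the chain rule applies.\<close>

lemma C1_restrict_bdry:
  fixes \<A> :: "('a::t2_space, 'm::finite option) chart set"
  assumes charts: "\<forall>c\<in>\<A>. riemannian_chart M H c" and f: "f \<in> C1 \<A>"
  shows "f \<in> C1 (bdry_atlas \<A>)"
  unfolding C1_def
proof (intro CollectI ballI)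
  fix b assume "b \<in> bdry_atlas \<A>"
  then obtain c where c: "c \<in> \<A>" and b: "b = bdry_chart c" by (auto simp: bdry_atlas_def)
  let ?e = "hyperplane_embedding :: real^'m \<Rightarrow> _"
  from charts c have inj: "inj_on (coord c) (cdom c)"
    unfolding riemannian_chart_def by (blast intro: homeomorphism_imp_inj_on)
  from f c obtain f' where
    f': "\<And>x. x \<in> cimg c \<Longrightarrow> (in_coords c f has_derivative f' x) (at x within cimg c)"
    and cont: "\<And>v. continuous_on (cimg c) (\<lambda>x. f' x v)"
    unfolding C1_def One_nat_def Ck_on.simps by blast
  have e_coord: "?e (coord b p) = coord c p" if "p \<in> cdom b" for p
    using that by (auto simp: b bdry_chart_def hyperplane_embedding_def vec_eq_iff split: option.split)
  have sub: "cdom b \<subseteq> cdom c" by (auto simp: b bdry_chart_def)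
  have e_cimg: "?e ` cimg b \<subseteq> cimg c" using e_coord sub by auto
  have inj_b: "inj_on (coord b) (cdom b)"
    using inj sub e_coord by (metis inj_on_def subsetD)
  have eq: "in_coords b f y = (in_coords c f \<circ> ?e) y" if "y \<in> cimg b" for y
    using that inj inj_b sub e_coord by (auto simp: in_coords_def inv_into_f_f subset_iff)
  have "(in_coords b f has_derivative (\<lambda>v. f' (?e y) (?e v))) (at y within cimg b)"
    if y: "y \<in> cimg b" for y
  proof -
    have "(?e has_derivative ?e) (at y within cimg b)"
      using bounded_linear_hyperplane_embedding by (rule bounded_linear_imp_has_derivative)
    moreover have "(in_coords c f has_derivative f' (?e y)) (at (?e y) within ?e ` cimg b)"
      using f' y e_cimg by (intro has_derivative_subset[OF f']) auto
    ultimately have "(in_coords c f \<circ> ?e has_derivative f' (?e y) \<circ> ?e) (at y within cimg b)"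
      by (rule diff_chain_within)
    then have "(in_coords b f has_derivative f' (?e y) \<circ> ?e) (at y within cimg b)"
      using y eq by (rule has_derivative_transform[rotated 2])
    then show ?thesis by (simp add: o_def)
  qed
  moreover have "continuous_on (cimg b) (\<lambda>y. f' (?e y) (?e v))" for v
    using continuous_on_compose2[OF cont
        linear_continuous_on[OF bounded_linear_hyperplane_embedding] e_cimg] .
  ultimately show "Ck_on 1 (cimg b) (in_coords b f)"
    unfolding One_nat_def Ck_on.simps
    by (intro exI[of _ "\<lambda>y v. f' (?e y) (?e v)"]) simp
qed

section \<open>The Poincare constant of the sticky measure\<close>

theorem proposition2p2:
  fixes \<Omega> :: "'a::t2_space set"
    and \<A> :: "('a, 'm::finite option) chart set"
    and \<Lambda> \<sigma> \<Lambda>\<^sub>\<alpha> \<sigma>\<^sub>\<beta> \<mu> :: "'a measure"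
    and \<alpha> \<beta> :: "'a \<Rightarrow> real"
    and d :: nat
    and A B K\<^sub>1 K\<^sub>2 K\<^sub>\<Gamma> C\<^sub>\<Lambda> L\<^sub>\<Lambda> C\<^sub>\<sigma> L\<^sub>\<sigma> :: real
  assumes manifold: "compact_connected_riemannian_manifold \<Omega> \<A>"
    and dimension: "d = CARD('m option)"
    and boundary: "connected (bdry \<A>)"
    and volume: "riemannian_volume \<Omega> \<A> \<Lambda>"
    and surface: "surface_measure \<Omega> \<A> \<sigma>"
    and A: "A = (\<integral>x. \<alpha> x \<partial>\<Lambda>)"
    and B: "B = (\<integral>x. \<beta> x \<partial>\<sigma>)"
    and \<Lambda>\<^sub>\<alpha>: "\<Lambda>\<^sub>\<alpha> = weighted (\<lambda>x. \<alpha> x / A) \<Lambda>"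
    and \<sigma>\<^sub>\<beta>: "\<sigma>\<^sub>\<beta> = weighted (\<lambda>x. \<beta> x / B) \<sigma>"
    and \<mu>: "\<mu> = sticky_measure \<Omega> (bdry \<A>) \<alpha> \<Lambda> \<beta> \<sigma>"
    and "prob_space \<mu>" and "0 < A" and "A < 1" and "0 < B" and "B < 1" and "A + B = 1"
    and "continuous_on \<Omega> \<alpha>" and "continuous_on \<Omega> \<beta>"
    and "AE x in \<Lambda>. \<alpha> x > 0" and "AE x in \<sigma>. \<beta> x > 0"
    and "(\<lambda>x. sqrt (\<alpha> x)) \<in> W12 \<A> \<Lambda>"
    and "(\<lambda>x. sqrt (\<beta> x)) \<in> W12 (bdry_atlas \<A>) \<sigma>"
    and "best_const (C1 \<A>) (Var \<Lambda>\<^sub>\<alpha>) (\<lambda>f. \<integral>x. grad_sq \<A> f x \<partial>\<Lambda>\<^sub>\<alpha>) = ereal C\<^sub>\<Lambda>"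
    and "best_const (C1 \<A>) (Ent_sq \<Lambda>\<^sub>\<alpha>) (\<lambda>f. \<integral>x. grad_sq \<A> f x \<partial>\<Lambda>\<^sub>\<alpha>) = ereal L\<^sub>\<Lambda>"
    and "best_const (C1 (bdry_atlas \<A>)) (Var \<sigma>\<^sub>\<beta>)
           (\<lambda>f. \<integral>x. grad_sq (bdry_atlas \<A>) f x \<partial>\<sigma>\<^sub>\<beta>) = ereal C\<^sub>\<sigma>"
    and "best_const (C1 (bdry_atlas \<A>)) (Ent_sq \<sigma>\<^sub>\<beta>)
           (\<lambda>f. \<integral>x. grad_sq (bdry_atlas \<A>) f x \<partial>\<sigma>\<^sub>\<beta>) = ereal L\<^sub>\<sigma>"
    and "compact_into_L2 \<A> (weighted \<alpha> \<Lambda>) id (weighted \<alpha> \<Lambda>)"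
    and "\<And>p::real. 2 \<le> p \<Longrightarrow> (d > 2 \<longrightarrow> p \<le> (2 * real d - 2) / (real d - 2)) \<Longrightarrow>
           continuously_embedded \<A> (weighted \<alpha> \<Lambda>) p (weighted \<beta> \<Lambda>)"
    and "compact_into_L2 (bdry_atlas \<A>) (weighted \<beta> \<sigma>) id (weighted \<beta> \<sigma>)"
    and "compact_trace \<A> (weighted \<alpha> \<Lambda>) (weighted \<beta> \<sigma>)"
    and "\<And>f. f \<in> C1 \<A> \<Longrightarrow> Var \<sigma>\<^sub>\<beta> f \<le> K\<^sub>\<Gamma> * (\<integral>x. grad_sq \<A> f x \<partial>\<Lambda>\<^sub>\<alpha>)"
    and "\<And>f. f \<in> C1 \<A> \<Longrightarrow>
           ((\<integral>x. f x \<partial>\<Lambda>\<^sub>\<alpha>) - (\<integral>x. f x \<partial>\<sigma>\<^sub>\<beta>))\<^sup>2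
             \<le> K\<^sub>1 * (\<integral>x. grad_sq \<A> f x \<partial>\<Lambda>\<^sub>\<alpha>) + K\<^sub>2 * (\<integral>x. grad_sq (bdry_atlas \<A>) f x \<partial>\<sigma>\<^sub>\<beta>)"
  shows "best_const (C1 \<A>) (Var \<mu>)
           (\<lambda>f. (\<integral>x. grad_sq \<A> f x * \<alpha> x \<partial>\<Lambda>) + (\<integral>x. grad_sq (bdry_atlas \<A>) f x * \<beta> x \<partial>\<sigma>))
         \<le> ereal (Max {C\<^sub>\<Lambda> + B * K\<^sub>1, A * K\<^sub>2,
              (B / A * K\<^sub>\<Gamma> * (C\<^sub>\<sigma> + A * K\<^sub>2) + (C\<^sub>\<Lambda> + B * K\<^sub>1) * C\<^sub>\<sigma>) / (B / A * K\<^sub>\<Gamma> + C\<^sub>\<sigma>)})"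
proof -
  let ?a = "\<lambda>f. \<integral>x. grad_sq \<A> f x \<partial>\<Lambda>\<^sub>\<alpha>"
  let ?b = "\<lambda>f. \<integral>x. grad_sq (bdry_atlas \<A>) f x \<partial>\<sigma>\<^sub>\<beta>"
  let ?E = "\<lambda>f. (\<integral>x. grad_sq \<A> f x * \<alpha> x \<partial>\<Lambda>) + (\<integral>x. grad_sq (bdry_atlas \<A>) f x * \<beta> x \<partial>\<sigma>)"
  define P where "P = C\<^sub>\<Lambda> + B * K\<^sub>1"
  define Q where "Q = A * K\<^sub>2"
  define k where "k = B / A * K\<^sub>\<Gamma>"
  define R where "R = Max {P, Q, (k * (C\<^sub>\<sigma> + Q) + P * C\<^sub>\<sigma>) / (k + C\<^sub>\<sigma>)}"
  note interior_Poincare = assms(23) and boundary_Poincare = assms(25)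
    and boundary_variance = assms(31) and difference_of_means = assms(32)
  note pos = \<open>0 < A\<close> \<open>0 < B\<close>

  have charts: "\<forall>c\<in>\<A>. riemannian_chart \<Omega> half_space c" and cover: "(\<Union>c\<in>\<A>. cdom c) = \<Omega>"
    and compact: "compact \<Omega>"
    using manifold by (auto simp: compact_connected_riemannian_manifold_def riemannian_atlas_def)
  have bdry_sub: "bdry \<A> \<subseteq> \<Omega>" using cover by (auto simp: bdry_def)
  have metric: "\<forall>v. v \<noteq> 0 \<longrightarrow> v \<bullet> (met c p *v v) > 0" if "c \<in> \<A>" "p \<in> cdom c" for c p
    using charts that by (auto simp: riemannian_chart_def)
  have grad_nonneg: "0 \<le> grad_sq \<A> f p" if "p \<in> \<Omega>" for f p
    using metric cover that by (intro grad_sq_nonneg) auto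
  have bdry_grad_nonneg: "0 \<le> grad_sq (bdry_atlas \<A>) f p" if "p \<in> bdry \<A>" for f p
  proof (rule grad_sq_nonneg)
    fix b assume "b \<in> bdry_atlas \<A>" "p \<in> cdom b"
    then obtain c where c: "c \<in> \<A>" "b = bdry_chart c" by (auto simp: bdry_atlas_def)
    with \<open>p \<in> cdom b\<close> have "p \<in> cdom c" by (simp add: bdry_chart_def)
    from bdry_metric_pos[OF metric[OF c(1) this]]
    show "\<forall>v. v \<noteq> 0 \<longrightarrow> v \<bullet> (met b p *v v) > 0" unfolding c(2) .
  next
    show "p \<in> (\<Union>b\<in>bdry_atlas \<A>. cdom b)"
      using that by (auto simp: bdry_def bdry_atlas_def bdry_chart_def)
  qed

  have sets_\<Lambda>: "sets \<Lambda> = sets (restrict_space borel \<Omega>)"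
    and sets_\<sigma>: "sets \<sigma> = sets (restrict_space borel (bdry \<A>))"
    using volume surface by (auto simp: riemannian_volume_def surface_measure_def)
  have space_\<Lambda>: "space \<Lambda> = \<Omega>" and space_\<sigma>: "space \<sigma> = bdry \<A>"
    using sets_eq_imp_space_eq[OF sets_\<Lambda>] sets_eq_imp_space_eq[OF sets_\<sigma>]
    by (auto simp: space_restrict_space)
  interpret measure_with_boundary_part \<Omega> "bdry \<A>" \<alpha> \<beta> \<Lambda> \<sigma>
  proof
    show "E \<inter> bdry \<A> \<in> sets \<sigma>" if "E \<in> sets \<Lambda>" for E
    proof -
      obtain S where "S \<in> sets borel" "E = \<Omega> \<inter> S"
        using \<open>E \<in> sets \<Lambda>\<close> by (auto simp: sets_\<Lambda> sets_restrict_space)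
      moreover from this have "E \<inter> bdry \<A> = bdry \<A> \<inter> S" using bdry_sub by auto
      ultimately show ?thesis by (auto simp: sets_\<sigma> sets_restrict_space)
    qed
  qed (use space_\<Lambda> space_\<sigma> bdry_sub in auto)

  have meas: "g \<in> borel_measurable \<Lambda>" "g \<in> borel_measurable \<sigma>"
    if "continuous_on \<Omega> g" for g :: "'a \<Rightarrow> real"
  proof -
    show "g \<in> borel_measurable \<Lambda>"
      using borel_measurable_continuous_on_restrict[OF that] measurable_cong_sets[OF sets_\<Lambda> refl]
      by blast
    then show "g \<in> borel_measurable \<sigma>" by (rule measurable_on_boundary)
  qed
  note \<alpha>_meas = meas(1)[OF \<open>continuous_on \<Omega> \<alpha>\<close>] and \<beta>_meas = meas(2)[OF \<open>continuous_on \<Omega> \<beta>\<close>]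
  interpret \<Lambda>\<^sub>\<alpha>: prob_space \<Lambda>\<^sub>\<alpha>
    unfolding \<Lambda>\<^sub>\<alpha> using \<open>0 < A\<close> \<open>AE x in \<Lambda>. \<alpha> x > 0\<close> unfolding A
    by (intro prob_space_normalised_density)
  interpret \<sigma>\<^sub>\<beta>: prob_space \<sigma>\<^sub>\<beta>
    unfolding \<sigma>\<^sub>\<beta> using \<open>0 < B\<close> \<open>AE x in \<sigma>. \<beta> x > 0\<close> unfolding B
    by (intro prob_space_normalised_density)
  have space_\<Lambda>\<^sub>\<alpha>: "space \<Lambda>\<^sub>\<alpha> = \<Omega>" and space_\<sigma>\<^sub>\<beta>: "space \<sigma>\<^sub>\<beta> = bdry \<A>"
    by (auto simp: \<Lambda>\<^sub>\<alpha> \<sigma>\<^sub>\<beta> space_\<Lambda> space_\<sigma>)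

  have integrable: "integrable \<Lambda>\<^sub>\<alpha> g" "integrable \<sigma>\<^sub>\<beta> g"
    if g: "continuous_on \<Omega> g" for g :: "'a \<Rightarrow> real"
  proof -
    obtain N where N: "\<And>x. x \<in> \<Omega> \<Longrightarrow> norm (g x) \<le> N"
      using compact_imp_bounded[OF compact_continuous_image[OF g compact]]
      by (auto simp: bounded_iff)
    show "integrable \<Lambda>\<^sub>\<alpha> g"
      by (rule \<Lambda>\<^sub>\<alpha>.integrable_const_bound[where B = N])
        (use N meas[OF g] space_\<Lambda>\<^sub>\<alpha> in \<open>auto simp: \<Lambda>\<^sub>\<alpha> intro!: AE_I2\<close>)
    show "integrable \<sigma>\<^sub>\<beta> g"
      by (rule \<sigma>\<^sub>\<beta>.integrable_const_bound[where B = N])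
        (use N meas[OF g] space_\<sigma>\<^sub>\<beta> bdry_sub in \<open>auto simp: \<sigma>\<^sub>\<beta> intro!: AE_I2\<close>)
  qed
  have integral_\<mu>: "(\<integral>x. g x \<partial>\<mu>) = A * (\<integral>x. g x \<partial>\<Lambda>\<^sub>\<alpha>) + B * (\<integral>x. g x \<partial>\<sigma>\<^sub>\<beta>)"
    if g: "continuous_on \<Omega> g" for g :: "'a \<Rightarrow> real"
  proof -
    have unscale: "(\<integral>x. g x \<partial>weighted w \<nu>) = c * (\<integral>x. g x \<partial>weighted (\<lambda>x. w x / c) \<nu>)"
      if "0 < c" "w \<in> borel_measurable \<nu>" "AE x in \<nu>. 0 < w x" "g \<in> borel_measurable \<nu>"
      for w c and \<nu> :: "'a measure"
      using integral_normalised_density[of c w \<nu> g] integral_normalised_density[of 1 w \<nu> g] that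
      by simp
    note interior = \<open>0 < A\<close> \<alpha>_meas \<open>AE x in \<Lambda>. \<alpha> x > 0\<close> meas(1)[OF g]
    note boundary = \<open>0 < B\<close> \<beta>_meas \<open>AE x in \<sigma>. \<beta> x > 0\<close> meas(2)[OF g]
    have "(\<integral>x. g x \<partial>\<mu>) = (\<integral>x. g x \<partial>weighted \<alpha> \<Lambda>) + (\<integral>x. g x \<partial>weighted \<beta> \<sigma>)"
      unfolding \<mu>
      using integrable_unnormalised_density[OF interior integrable(1)[OF g, unfolded \<Lambda>\<^sub>\<alpha>]]
        integrable_unnormalised_density[OF boundary integrable(2)[OF g, unfolded \<sigma>\<^sub>\<beta>]]
      by (rule integral_sticky[OF meas(1)[OF g]])
    then show ?thesis
      unfolding \<Lambda>\<^sub>\<alpha> \<sigma>\<^sub>\<beta> by (simp only: unscale[OF interior] unscale[OF boundary])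
  qed

  have a_nonneg: "0 \<le> ?a f" for f
    by (intro integral_nonneg_AE AE_I2) (simp add: space_\<Lambda>\<^sub>\<alpha> grad_nonneg)
  have b_nonneg: "0 \<le> ?b f" for f
    by (intro integral_nonneg_AE AE_I2) (simp add: space_\<sigma>\<^sub>\<beta> bdry_grad_nonneg)
  have energy: "A * ?a f + B * ?b f \<le> ?E f" for f
    unfolding \<Lambda>\<^sub>\<alpha> \<sigma>\<^sub>\<beta>
    using \<alpha>_meas \<beta>_meas pos \<open>AE x in \<Lambda>. \<alpha> x > 0\<close> \<open>AE x in \<sigma>. \<beta> x > 0\<close>
    by (intro add_mono integral_normalised_density_le)
      (auto simp: space_\<Lambda> space_\<sigma> grad_nonneg bdry_grad_nonneg)

  have key: "0 \<le> Var \<mu> f \<and> Var \<mu> f \<le> R * (A * ?a f + B * ?b f)" if f: "f \<in> C1 \<A>" for f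
  proof -
    have cont: "continuous_on \<Omega> f" by (rule C1_continuous_on[OF charts cover f])
    then have cont2: "continuous_on \<Omega> (\<lambda>x. (f x)\<^sup>2)" by (intro continuous_intros)
    have Var_\<Lambda>: "0 \<le> Var \<Lambda>\<^sub>\<alpha> f" "Var \<Lambda>\<^sub>\<alpha> f \<le> C\<^sub>\<Lambda> * ?a f"
      using \<Lambda>\<^sub>\<alpha>.Var_nonneg[OF integrable(1)[OF cont] integrable(1)[OF cont2]]
        sharp_constant_is_admissible[OF interior_Poincare f a_nonneg] by auto
    have Var_\<sigma>: "0 \<le> Var \<sigma>\<^sub>\<beta> f" "Var \<sigma>\<^sub>\<beta> f \<le> C\<^sub>\<sigma> * ?b f" "Var \<sigma>\<^sub>\<beta> f \<le> K\<^sub>\<Gamma> * ?a f"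
      using \<sigma>\<^sub>\<beta>.Var_nonneg[OF integrable(2)[OF cont] integrable(2)[OF cont2]]
        sharp_constant_is_admissible[OF boundary_Poincare C1_restrict_bdry[OF charts f] b_nonneg]
        boundary_variance[OF f] by auto
    define D where "D = (\<integral>x. f x \<partial>\<Lambda>\<^sub>\<alpha>) - (\<integral>x. f x \<partial>\<sigma>\<^sub>\<beta>)"
    have D: "D\<^sup>2 \<le> K\<^sub>1 * ?a f + K\<^sub>2 * ?b f" using difference_of_means[OF f] by (simp add: D_def)
    have Var_\<mu>: "Var \<mu> f = A * Var \<Lambda>\<^sub>\<alpha> f + B * Var \<sigma>\<^sub>\<beta> f + A * B * D\<^sup>2"
      unfolding D_def
      by (rule Var_mixture[OF \<open>A + B = 1\<close> integral_\<mu>[OF cont] integral_\<mu>[OF cont2]])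
    also have "\<dots> \<le> A * (C\<^sub>\<Lambda> * ?a f) + B * Var \<sigma>\<^sub>\<beta> f + A * B * (K\<^sub>1 * ?a f + K\<^sub>2 * ?b f)"
      using pos Var_\<Lambda> D by (intro add_mono mult_left_mono order_refl) auto
    also have "\<dots> = P * (A * ?a f) + Q * (B * ?b f) + B * Var \<sigma>\<^sub>\<beta> f"
      by (simp add: P_def Q_def algebra_simps)
    also have "\<dots> \<le> R * (A * ?a f + B * ?b f)"
      unfolding R_def
    proof (rule interpolate_two_bounds)
      show "B * Var \<sigma>\<^sub>\<beta> f \<le> k * (A * ?a f)"
        using mult_left_mono[OF Var_\<sigma>(3), of B] pos by (simp add: k_def)
      show "B * Var \<sigma>\<^sub>\<beta> f \<le> C\<^sub>\<sigma> * (B * ?b f)"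
        using mult_left_mono[OF Var_\<sigma>(2), of B] pos by (simp add: ac_simps)
    qed (use pos a_nonneg b_nonneg Var_\<sigma> in auto)
    finally show ?thesis using Var_\<mu> pos Var_\<Lambda> Var_\<sigma> by simp
  qed

  \<comment> \<open>A function of positive interior energy shows that \<open>R\<close> is nonnegative, whatever the signs of the given
    constants; this allows passing from \<open>A * a + B * b\<close> to the possibly larger energy.\<close>
  have "0 \<le> R"
  proof -
    obtain f where f: "f \<in> C1 \<A>" "?a f \<noteq> 0"
      using finite_sharp_constant_nonzero_energy[OF interior_Poincare] by blast
    have "0 < A * ?a f"
      using f(2) a_nonneg[of f] pos by (simp add: zero_less_mult_iff order_less_le)
    then have "0 < A * ?a f + B * ?b f"
      using pos mult_nonneg_nonneg[OF less_imp_le[OF \<open>0 < B\<close>] b_nonneg[of f]] by linarith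
    moreover have "0 \<le> R * (A * ?a f + B * ?b f)" using key[OF f(1)] by linarith
    ultimately show ?thesis by (simp add: zero_le_mult_iff)
  qed
  then have "Var \<mu> f \<le> R * ?E f" if "f \<in> C1 \<A>" for f
    using key[OF that] mult_left_mono[OF energy[of f]] by (meson order_trans)
  then have "best_const (C1 \<A>) (Var \<mu>) ?E \<le> ereal R"
    unfolding best_const_def by (intro Inf_lower) auto
  then show ?thesis by (simp add: R_def P_def Q_def k_def)
qed

end
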